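(* Let $q\in(2,\infty)$ and let $(Y,d_Y)$ be a metric space with roundness $2$ (in particular, $Y$ may be any Alexandrov space of non-positive curvature). Then there is a constant $\alpha>0$ such that for every $k\in\mathbb{N}$, $$\mathsf{c}_Y(\ell_q^k)\ge\alpha\,k^{\frac12-\frac1q}.$$
   Context: $(Y,d_Y)$ has roundness $2$ if for all $x_1,x_2,x_3,x_4\in Y$, $d_Y(x_1,x_3)^2+d_Y(x_2,x_4)^2\le d_Y(x_1,x_2)^2+d_Y(x_2,x_3)^2+d_Y(x_3,x_4)^2+d_Y(x_4,x_1)^2$. Alexandrov spaces of non-positive curvature are the (geodesic) CAT(0) spaces. $\ell_q^k$ is $\mathbb{R}^k$ with the $\ell_q$-norm. $\mathsf{c}_Y(X)\in[1,\infty]$ is the $Y$-distortion of $X$: the infimum of all $D\ge1$ for which there are $f:X\to Y$ and $r>0$ with $r\,d_X(x,y)\le d_Y(f(x),f(y))\le rD\,d_X(x,y)$ for all $x,y\in X$ (and $+\infty$ if no such $D$ exists). *)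

theory Defs
  imports "HOL-Analysis.Analysis"
begin

definition roundness_two :: "'a set \<Rightarrow> ('a \<Rightarrow> 'a \<Rightarrow> real) \<Rightarrow> bool" where
  "roundness_two Y d \<longleftrightarrow>
     (\<forall>x1\<in>Y. \<forall>x2\<in>Y. \<forall>x3\<in>Y. \<forall>x4\<in>Y.
        (d x1 x3)\<^sup>2 + (d x2 x4)\<^sup>2 \<le> (d x1 x2)\<^sup>2 + (d x2 x3)\<^sup>2 + (d x3 x4)\<^sup>2 + (d x4 x1)\<^sup>2)"

definition geodesic_from_to ::
    "'a set \<Rightarrow> ('a \<Rightarrow> 'a \<Rightarrow> real) \<Rightarrow> 'a \<Rightarrow> 'a \<Rightarrow> (real \<Rightarrow> 'a) \<Rightarrow> bool" where
  "geodesic_from_to Y d x y c \<longleftrightarrow>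
     c \<in> {0..d x y} \<rightarrow> Y \<and> c 0 = x \<and> c (d x y) = y \<and>
     (\<forall>s\<in>{0..d x y}. \<forall>t\<in>{0..d x y}. d (c s) (c t) = \<bar>s - t\<bar>)"

definition geodesic_metric_space :: "'a set \<Rightarrow> ('a \<Rightarrow> 'a \<Rightarrow> real) \<Rightarrow> bool" where
  "geodesic_metric_space Y d \<longleftrightarrow>
     Metric_space Y d \<and> (\<forall>x\<in>Y. \<forall>y\<in>Y. \<exists>c. geodesic_from_to Y d x y c)"

(* Comparison triangles live in the Euclidean plane real^2.  The inequality is stated for
   points u, v on the two sides issuing from the vertex x; since x, y, z and the geodesics
   are arbitrary, relabelling the vertices covers every pair of sides of every geodesic
   triangle, and two points on the same side satisfy it with equality. *)
definition CAT0_space :: "'a set \<Rightarrow> ('a \<Rightarrow> 'a \<Rightarrow> real) \<Rightarrow> bool" where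
  "CAT0_space Y d \<longleftrightarrow>
     geodesic_metric_space Y d \<and>
     (\<forall>x\<in>Y. \<forall>y\<in>Y. \<forall>z\<in>Y. \<forall>c c'.
        geodesic_from_to Y d x y c \<longrightarrow> geodesic_from_to Y d x z c' \<longrightarrow>
        (\<forall>(x' :: real^2) (y' :: real^2) (z' :: real^2).
           dist x' y' = d x y \<longrightarrow> dist y' z' = d y z \<longrightarrow> dist x' z' = d x z \<longrightarrow>
           (\<forall>s\<in>{0..d x y}. \<forall>t\<in>{0..d x z}.
              \<forall>u'\<in>closed_segment x' y'. \<forall>v'\<in>closed_segment x' z'.
                dist x' u' = s \<longrightarrow> dist x' v' = t \<longrightarrow> d (c s) (c' t) \<le> dist u' v')))"

(* The dimension k varies inside a formula, so vectors of R^k are the functions on the index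
   set {..<k}, extended by undefined outside it. *)
definition lq_carrier :: "nat \<Rightarrow> (nat \<Rightarrow> real) set" where
  "lq_carrier k = {..<k} \<rightarrow>\<^sub>E UNIV"

definition lq_dist :: "real \<Rightarrow> nat \<Rightarrow> (nat \<Rightarrow> real) \<Rightarrow> (nat \<Rightarrow> real) \<Rightarrow> real" where
  "lq_dist q k x y = (\<Sum>i<k. \<bar>x i - y i\<bar> powr q) powr (1 / q)"

(* The infimum is taken in ereal, so it is \<infinity> when no admissible D exists. *)
definition distortion ::
    "'y set \<Rightarrow> ('y \<Rightarrow> 'y \<Rightarrow> real) \<Rightarrow> 'x set \<Rightarrow> ('x \<Rightarrow> 'x \<Rightarrow> real) \<Rightarrow> ereal" where
  "distortion Y dY X dX =
     Inf {ereal D |D. 1 \<le> D \<and>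
       (\<exists>f\<in>X \<rightarrow> Y. \<exists>r>0. \<forall>x\<in>X. \<forall>y\<in>X.
          r * dX x y \<le> dY (f x) (f y) \<and> dY (f x) (f y) \<le> r * D * dX x y)}"

end

theory Submission
  imports Defs
begin

text \<open>
  Let \<open>w \<in> {0, 1, 2}\<^sup>k\<close> with \<open>w\<^sub>i = 1\<close>. The segment from \<open>x\<close> to \<open>x + t w\<close> is the
  diagonal of a parallelogram whose other two vertices are \<open>x + t (w \<plusminus> e\<^sub>i) / 2\<close>.
  Roundness 2 of the image of this parallelogram bounds the squared length of the image of the
  diagonal plus the squared distance of the two other vertices by the sum of the squared sides,
  and the sides are again of the form \<open>(t / 2) w'\<close> with \<open>w' \<in> {0, 1, 2}\<^sup>k\<close>. Starting from
  \<open>w = (1, \<dots>, 1)\<close> and using every coordinate once, the gains \<open>\<parallel>t e\<^sub>i\<parallel>\<^sup>2\<close>, normalised by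
  scale, add up to \<open>k\<close>, while all normalised squared edges are at most \<open>D\<^sup>2 (2 k\<^bsup>1/q\<^esup>)\<^sup>2\<close>.
  Hence \<open>D \<ge> k\<^bsup>1/2 - 1/q\<^esup> / 2\<close>.
\<close>

section \<open>Lower bound for the distortion of \<open>lq_carrier k\<close>\<close>

lemma lq_dist_le:
  assumes q: "0 < q" and c: "0 \<le> c" and le: "\<And>i. i < k \<Longrightarrow> \<bar>x i - y i\<bar> \<le> c"
  shows "lq_dist q k x y \<le> c * real k powr (1 / q)"
proof -
  have "(\<Sum>i<k. \<bar>x i - y i\<bar> powr q) \<le> (\<Sum>i<k. c powr q)"
    using le q by (intro sum_mono powr_mono2) auto
  then have "(\<Sum>i<k. \<bar>x i - y i\<bar> powr q) powr (1 / q) \<le> (real k * c powr q) powr (1 / q)"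
    using q by (intro powr_mono2) (auto intro: sum_nonneg)
  also have "\<dots> = c * real k powr (1 / q)"
    using q c by (simp add: powr_mult powr_powr)
  finally show ?thesis
    by (simp add: lq_dist_def)
qed

lemma abs_diff_le_lq_dist:
  assumes q: "0 < q" and j: "j < k"
  shows "\<bar>x j - y j\<bar> \<le> lq_dist q k x y"
proof -
  have "\<bar>x j - y j\<bar> powr q \<le> (\<Sum>i<k. \<bar>x i - y i\<bar> powr q)"
    using j by (intro member_le_sum) auto
  then have "(\<bar>x j - y j\<bar> powr q) powr (1 / q) \<le> lq_dist q k x y"
    unfolding lq_dist_def using q by (intro powr_mono2) auto
  then show ?thesis
    using q by (simp add: powr_powr)
qed

lemma lq_dist_restrict [simp]:
  "lq_dist q k (restrict x {..<k}) (restrict y {..<k}) = lq_dist q k x y"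
  unfolding lq_dist_def by simp

text \<open>Here \<open>n\<close> counts the coordinates not yet split. Later entries of
  \<open>w\<close> are only bounded by 2, since splitting turns a 1 into 0 or 2. All terms scale
  like \<open>t\<close> squared, so four copies at scale \<open>t / 2\<close> add up to one at scale
  \<open>t\<close>.\<close>

lemma roundness_two_diamond:
  fixes g :: "(nat \<Rightarrow> real) \<Rightarrow> 'a"
  assumes round: "roundness_two Y d" and met: "Metric_space Y d" and q: "0 < q"
    and r: "0 \<le> r" and D: "0 \<le> D" and gY: "\<And>x. g x \<in> Y"
    and lower: "\<And>x y. r * lq_dist q k x y \<le> d (g x) (g y)"
    and upper: "\<And>x y. d (g x) (g y) \<le> r * D * lq_dist q k x y"
    and "n \<le> k" and "0 \<le> t"
    and "\<And>i. i < n \<Longrightarrow> w i = 1" and "\<And>i. \<bar>w i\<bar> \<le> 2"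
  shows "(d (g x) (g (\<lambda>i. x i + t * w i)))\<^sup>2 + real n * (r * t)\<^sup>2
           \<le> (2 * r * D * t * real k powr (1 / q))\<^sup>2"
  using assms(9-)
proof (induction n arbitrary: x t w)
  case 0
  interpret Metric_space Y d by (fact met)
  have "lq_dist q k x (\<lambda>i. x i + t * w i) \<le> (t * 2) * real k powr (1 / q)"
    using 0 q by (intro lq_dist_le) (auto simp: abs_mult intro!: mult_left_mono)
  then have "r * D * lq_dist q k x (\<lambda>i. x i + t * w i) \<le> r * D * ((t * 2) * real k powr (1 / q))"
    using r D by (intro mult_left_mono) auto
  with upper[of x "\<lambda>i. x i + t * w i"]
  have "d (g x) (g (\<lambda>i. x i + t * w i)) \<le> 2 * r * D * t * real k powr (1 / q)"
    by (simp add: mult_ac)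
  then show ?case
    by (simp add: power_mono)
next
  case (Suc n)
  interpret Metric_space Y d by (fact met)
  \<comment> \<open>As \<open>w n = 1\<close>, the vector \<open>w\<close> is the mean of
    \<open>p\<close> and \<open>m\<close>; both still equal 1 below \<open>n\<close>, so the
    induction hypothesis covers all four sides.\<close>
  define p where "p = w(n := 2)"
  define m where "m = w(n := 0)"
  define P where "P = (\<lambda>i. x i + t / 2 * p i)"
  define M where "M = (\<lambda>i. x i + t / 2 * m i)"
  define z where "z = (\<lambda>i. x i + t * w i)"
  define B where
    "B = (2 * r * D * (t / 2) * real k powr (1 / q))\<^sup>2 - real n * (r * (t / 2))\<^sup>2"
  have sum_pm: "p i + m i = 2 * w i" for i
    using Suc.prems(3)[of n] by (simp add: p_def m_def)
  have Pz: "z = (\<lambda>i. P i + t / 2 * m i)" and Mz: "z = (\<lambda>i. M i + t / 2 * p i)"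
  proof -
    have "t * w i = t / 2 * p i + t / 2 * m i" for i
      using sum_pm[of i] by (simp add: field_simps flip: distrib_left)
    then show "z = (\<lambda>i. P i + t / 2 * m i)" and "z = (\<lambda>i. M i + t / 2 * p i)"
      by (simp_all add: z_def P_def M_def algebra_simps)
  qed
  have IH: "(d (g y) (g (\<lambda>i. y i + t / 2 * v i)))\<^sup>2 \<le> B" if "v = p \<or> v = m" for y v
  proof -
    have "\<And>i. i < n \<Longrightarrow> v i = 1" "\<And>i. \<bar>v i\<bar> \<le> 2"
      using that Suc.prems(3,4) by (auto simp: p_def m_def)
    with Suc.IH[of "t / 2" v y] Suc.prems show ?thesis
      by (auto simp: B_def)
  qed
  have sides: "(d (g x) (g P))\<^sup>2 \<le> B" "(d (g P) (g z))\<^sup>2 \<le> B"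
       "(d (g z) (g M))\<^sup>2 \<le> B" "(d (g M) (g x))\<^sup>2 \<le> B"
    using IH[of p x, folded P_def] IH[of m P, folded Pz] IH[of p M, folded Mz] IH[of m x, folded M_def]
      commute[of "g M"] by auto
  \<comment> \<open>\<open>P\<close> and \<open>M\<close> differ only in coordinate
    \<open>n\<close>, by \<open>t / 2 * 2\<close>.\<close>
  have "t \<le> lq_dist q k P M"
    using abs_diff_le_lq_dist[OF q, of n k P M] Suc.prems by (simp add: P_def M_def p_def m_def)
  then have "r * t \<le> d (g P) (g M)"
    using lower[of P M] mult_left_mono[OF _ r] by (blast intro: order_trans)
  then have "(r * t)\<^sup>2 \<le> (d (g P) (g M))\<^sup>2"
    using r Suc.prems by (intro power_mono) auto
  moreover have "(d (g x) (g z))\<^sup>2 + (d (g P) (g M))\<^sup>2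
      \<le> (d (g x) (g P))\<^sup>2 + (d (g P) (g z))\<^sup>2 + (d (g z) (g M))\<^sup>2 + (d (g M) (g x))\<^sup>2"
    using round gY unfolding roundness_two_def by blast
  \<comment> \<open>\<open>4 * B\<close> is the target bound minus
    \<open>real n * (r * t)\<^sup>2\<close>; the term gained on the left raises \<open>n\<close> to
    \<open>Suc n\<close>.\<close>
  ultimately have "(d (g x) (g z))\<^sup>2 + (r * t)\<^sup>2 \<le> 4 * B"
    using sides by linarith
  then show ?case
    by (simp add: z_def B_def power_mult_distrib power_divide algebra_simps)
qed

lemma roundness_two_distortion_lq:
  assumes q: "0 < q" and met: "Metric_space Y d" and round: "roundness_two Y d"
  shows "ereal (1/2 * real k powr (1/2 - 1/q)) \<le> distortion Y d (lq_carrier k) (lq_dist q k)"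
  unfolding distortion_def
proof (intro Inf_greatest, clarify)
  fix D f and r :: real
  assume D: "1 \<le> D" and f: "f \<in> lq_carrier k \<rightarrow> Y" and r: "0 < r"
    and bilip: "\<forall>x\<in>lq_carrier k. \<forall>y\<in>lq_carrier k.
      r * lq_dist q k x y \<le> d (f x) (f y) \<and> d (f x) (f y) \<le> r * D * lq_dist q k x y"
  \<comment> \<open>Restricting first makes \<open>g\<close> total, so the points of the induction
    need not lie in the carrier.\<close>
  define g where "g x = f (restrict x {..<k})" for x
  have in_carrier: "restrict x {..<k} \<in> lq_carrier k" for x :: "nat \<Rightarrow> real"
    by (auto simp: lq_carrier_def)
  have "(d (g (\<lambda>_. 0)) (g (\<lambda>i. 0 + 1 * 1)))\<^sup>2 + real k * (r * 1)\<^sup>2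
          \<le> (2 * r * D * 1 * real k powr (1 / q))\<^sup>2"
  proof (rule roundness_two_diamond[OF round met q])
    show "g x \<in> Y" for x
      unfolding g_def using f in_carrier by blast
    show "r * lq_dist q k x y \<le> d (g x) (g y)" "d (g x) (g y) \<le> r * D * lq_dist q k x y" for x y
      unfolding g_def
      using bilip[rule_format, OF in_carrier in_carrier, of x y] by simp_all
  qed (use r D in auto)
  then have "real k * (r * 1)\<^sup>2 \<le> (2 * r * D * 1 * real k powr (1 / q))\<^sup>2"
    by (rule order_trans[rotated]) simp
  then have "real k * r\<^sup>2 \<le> (2 * D * real k powr (1 / q))\<^sup>2 * r\<^sup>2"
    by (simp add: power_mult_distrib mult_ac)
  then have "real k \<le> (2 * D * real k powr (1 / q))\<^sup>2"
    using r by simp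
  then have le: "sqrt (real k) \<le> 2 * D * real k powr (1 / q)"
    using D by (intro real_le_lsqrt) auto
  have "real k powr (1/2 - 1/q) \<le> 2 * D"
  \<comment> \<open>For \<open>k = 0\<close> the left side is \<open>0 powr _ = 0\<close>; otherwise
    one may divide by k^(1/q).\<close>
  proof (cases "k = 0")
    case False
    then have "real k powr (1/2 - 1/q) = sqrt (real k) / real k powr (1/q)"
      by (simp only: powr_diff powr_half_sqrt of_nat_0_le_iff)
    also have "\<dots> \<le> 2 * D"
      using le False by (simp add: divide_le_eq)
    finally show ?thesis .
  qed (use D in simp)
  then show "ereal (1/2 * real k powr (1/2 - 1/q)) \<le> ereal D"
    by simp
qed

section \<open>CAT(0) spaces have roundness 2\<close>

lemma median_dist:
  fixes x y z :: "'b :: real_inner"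
  shows "(dist (midpoint x y) z)\<^sup>2 = (dist x z)\<^sup>2 / 2 + (dist y z)\<^sup>2 / 2 - (dist x y)\<^sup>2 / 4"
proof -
  \<comment> \<open>The claim is the parallelogram law for \<open>x - z\<close> and
    \<open>y - z\<close>.\<close>
  have "midpoint x y - z = (1/2) *\<^sub>R ((x - z) + (y - z))"
    by (simp add: midpoint_def algebra_simps flip: scaleR_add_left)
  then have "(dist (midpoint x y) z)\<^sup>2 = (norm ((x - z) + (y - z)))\<^sup>2 / 4"
    by (simp add: dist_norm power_divide)
  moreover have "(dist x y)\<^sup>2 = (norm ((x - z) - (y - z)))\<^sup>2"
    by (simp add: dist_norm)
  ultimately show ?thesis
    by (simp add: dist_norm power2_norm_eq_inner inner_simps inner_commute field_simps)
qed

text \<open>Put the vertices at (0,0), (a,0) and (u,v), with u given by the law of cosines. The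
  triangle inequalities yield |u| \<le> b, so v exists.\<close>

lemma comparison_triangle_exists:
  fixes a b c :: real
  assumes "0 \<le> a" "0 \<le> b" "0 \<le> c" and tri: "a \<le> b + c" "b \<le> a + c" "c \<le> a + b"
  obtains x y z :: "real^2" where "dist x y = a" "dist y z = c" "dist x z = b"
proof (cases "a = 0")
  case True
  then have "b = c" using tri by simp
  have "dist 0 (vector [b, 0] :: real^2) = b"
    using \<open>0 \<le> b\<close> by (simp add: dist_norm norm_vec_def L2_set_def sum_2)
  with that[of 0 0 "vector [b, 0]"] True \<open>b = c\<close> show thesis by simp
next
  case False
  then have a: "0 < a" using assms by simp
  define u where "u = (a\<^sup>2 + b\<^sup>2 - c\<^sup>2) / (2 * a)"
  have u: "2 * a * u = a\<^sup>2 + b\<^sup>2 - c\<^sup>2"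
    using a by (simp add: u_def)
  have "c\<^sup>2 \<le> (a + b)\<^sup>2" "\<bar>a - b\<bar>\<^sup>2 \<le> c\<^sup>2"
    using assms by (intro power_mono; simp)+
  then have "2 * a * u \<le> 2 * a * b" "2 * a * (- b) \<le> 2 * a * u"
    using u by (auto simp: power2_eq_square algebra_simps)
  then have "u \<le> b" "- b \<le> u"
    using a by (simp_all only: mult_le_cancel_left_pos mult_pos_pos zero_less_numeral)
  then have "\<bar>u\<bar> \<le> b"
    by simp
  then have "u\<^sup>2 \<le> b\<^sup>2"
    using abs_le_square_iff[of u b] by simp
  define v where "v = sqrt (b\<^sup>2 - u\<^sup>2)"
  have v: "v\<^sup>2 = b\<^sup>2 - u\<^sup>2"
    using \<open>u\<^sup>2 \<le> b\<^sup>2\<close> by (simp add: v_def)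
  have "(a - u)\<^sup>2 + v\<^sup>2 = c\<^sup>2"
    using u v by (simp add: power2_diff)
  show thesis
  proof (rule that[of 0 "vector [a, 0]" "vector [u, v]"])
    show "dist 0 (vector [a, 0] :: real^2) = a"
      using a by (simp add: dist_norm norm_vec_def L2_set_def sum_2)
    show "dist (vector [a, 0] :: real^2) (vector [u, v]) = c"
      using \<open>(a - u)\<^sup>2 + v\<^sup>2 = c\<^sup>2\<close> \<open>0 \<le> c\<close> by (simp add: dist_norm norm_vec_def L2_set_def sum_2)
    show "dist 0 (vector [u, v] :: real^2) = b"
      using v \<open>0 \<le> b\<close> by (simp add: dist_norm norm_vec_def L2_set_def sum_2)
  qed
qed

text \<open>The CN inequality of Bruhat and Tits.\<close>

lemma CAT0_midpoint_ineq:
  assumes cat: "CAT0_space Y d" and "x \<in> Y" "y \<in> Y" "z \<in> Y"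
    and c: "geodesic_from_to Y d x y c"
  shows "(d (c (d x y / 2)) z)\<^sup>2 \<le> (d x z)\<^sup>2 / 2 + (d y z)\<^sup>2 / 2 - (d x y)\<^sup>2 / 4"
proof -
  interpret Metric_space Y d
    using cat by (simp add: CAT0_space_def geodesic_metric_space_def)
  obtain c' where c': "geodesic_from_to Y d x z c'"
    using cat \<open>x \<in> Y\<close> \<open>z \<in> Y\<close> unfolding CAT0_space_def geodesic_metric_space_def by meson
  obtain x' y' z' :: "real^2"
    where tri: "dist x' y' = d x y" "dist y' z' = d y z" "dist x' z' = d x z"
  proof (rule comparison_triangle_exists[of "d x y" "d x z" "d y z"])
    show "d x y \<le> d x z + d y z" "d x z \<le> d x y + d y z" "d y z \<le> d x y + d x z"
      using triangle[of x z y] triangle[of x y z] triangle[of y x z] assms commute by metis+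
  qed auto
  \<comment> \<open>The CAT(0) condition compares points on two sides, so z enters as the endpoint
    of \<open>c'\<close>.\<close>
  have "d (c (d x y / 2)) (c' (d x z)) \<le> dist (midpoint x' y') z'"
  proof -
    have "d x y / 2 \<in> {0..d x y}" "d x z \<in> {0..d x z}" "midpoint x' y' \<in> closed_segment x' y'"
      "dist x' (midpoint x' y') = d x y / 2"
      using tri by (auto simp: dist_midpoint midpoint_in_closed_segment)
    with cat assms c' tri show ?thesis
      unfolding CAT0_space_def by (metis ends_in_segment(2))
  qed
  moreover have "c' (d x z) = z"
    using c' by (simp add: geodesic_from_to_def)
  ultimately have "(d (c (d x y / 2)) z)\<^sup>2 \<le> (dist (midpoint x' y') z')\<^sup>2"
    by (simp add: power_mono)
  then show ?thesis
    by (simp add: median_dist tri)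
qed

text \<open>Apply the CN inequality at the midpoint \<open>m\<close> of one diagonal to
  \<open>x2\<close> and \<open>x4\<close>, double and add; the other diagonal is bounded through
  \<open>m\<close> by (a + b)^2 \<le> 2a^2 + 2b^2.\<close>

lemma CAT0_imp_roundness_two:
  assumes cat: "CAT0_space Y d"
  shows "roundness_two Y d"
  unfolding roundness_two_def
proof (intro ballI)
  fix x1 x2 x3 x4 assume Y: "x1 \<in> Y" "x2 \<in> Y" "x3 \<in> Y" "x4 \<in> Y"
  interpret Metric_space Y d
    using cat by (simp add: CAT0_space_def geodesic_metric_space_def)
  obtain c where c: "geodesic_from_to Y d x1 x3 c"
    using cat Y unfolding CAT0_space_def geodesic_metric_space_def by blast
  define m where "m = c (d x1 x3 / 2)"
  have m: "m \<in> Y"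
    using c unfolding m_def geodesic_from_to_def by (auto simp: Pi_iff)
  have "d x2 x4 \<le> d m x2 + d m x4"
    using triangle[of x2 m x4] Y m by (simp add: commute)
  then have "(d x2 x4)\<^sup>2 \<le> (d m x2 + d m x4)\<^sup>2"
    by (simp add: power_mono)
  also have "\<dots> \<le> 2 * (d m x2)\<^sup>2 + 2 * (d m x4)\<^sup>2"
    using zero_le_power2[of "d m x2 - d m x4"] by (simp add: power2_eq_square algebra_simps)
  finally have "(d x2 x4)\<^sup>2 \<le> 2 * (d m x2)\<^sup>2 + 2 * (d m x4)\<^sup>2" .
  with CAT0_midpoint_ineq[OF cat _ _ _ c, of x2] CAT0_midpoint_ineq[OF cat _ _ _ c, of x4]
  show "(d x1 x3)\<^sup>2 + (d x2 x4)\<^sup>2 \<le> (d x1 x2)\<^sup>2 + (d x2 x3)\<^sup>2 + (d x3 x4)\<^sup>2 + (d x4 x1)\<^sup>2"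
    using Y by (simp add: m_def[symmetric] commute)
qed

theorem corollary3:
  fixes q :: real and Y :: "'a set" and d :: "'a \<Rightarrow> 'a \<Rightarrow> real"
  assumes "2 < q" and "Metric_space Y d"
  shows "(roundness_two Y d \<longrightarrow>
            (\<exists>\<alpha>::real. 0 < \<alpha> \<and>
               (\<forall>k::nat. ereal (\<alpha> * real k powr (1/2 - 1/q))
                           \<le> distortion Y d (lq_carrier k) (lq_dist q k)))) \<and>
         (CAT0_space Y d \<longrightarrow> roundness_two Y d)"
proof (intro conjI impI)
  assume "roundness_two Y d"
  then have "\<forall>k. ereal (1/2 * real k powr (1/2 - 1/q)) \<le> distortion Y d (lq_carrier k) (lq_dist q k)"
    using assms by (intro allI roundness_two_distortion_lq) auto
  then show "\<exists>\<alpha>::real. 0 < \<alpha> \<and>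
      (\<forall>k::nat. ereal (\<alpha> * real k powr (1/2 - 1/q)) \<le> distortion Y d (lq_carrier k) (lq_dist q k))"
    by (intro exI[of _ "1/2"]) simp
qed (rule CAT0_imp_roundness_two)

end
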